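(* Let $G$ be a multigraph, $L$ a list assignment on $V(G)$, and $P$ an $L$-pot. If $G$ is $(L,P)$-fixable, then $(G,L)$ is superabundant.
   Context: Multigraphs are finite and loopless (parallel edges allowed). A list assignment $L$ on $V(G)$ assigns to each vertex $v$ a finite set $L(v)$ of colors. Put $\operatorname{pot}(L)=\bigcup_{v\in V(G)}L(v)$. An $L$-pot is a (finite) set $P\supseteq \operatorname{pot}(L)$. An $L$-edge-coloring of $G$ is an assignment $\pi$ of colors to the edges such that $\pi(e)\in L(x)\cap L(y)$ for every edge $e$ with endpoints $x,y$, and any two distinct edges sharing an endpoint get different colors. For distinct colors $a,b\in P$, let $S_{L,a,b}=\{v\in V(G) : |\{a,b\}\cap L(v)|=1\}$. Swapping $a$ and $b$ in $L(v)$ for $v\in S_{L,a,b}$ means replacing whichever of $a,b$ is in $L(v)$ by the other one. Being $(L,P)$-fixable is defined recursively (as the least relation satisfying the following, so a finite number of applications of (2) is used): $G$ is $(L,P)$-fixable if either (1) $G$ has an $L$-edge-coloring; or (2) there are distinct colors $a,b\in P$ such that for every partition $X_1,\dots,X_t$ of $S_{L,a,b}$ into sets of size at most two, there exists $J\subseteq\{1,\dots,t\}$ such that $G$ is $(L',P)$-fixable, where $L'$ is formed from $L$ by swapping $a$ and $b$ in $L(v)$ for every $v\in\bigcup_{i\in J}X_i$. For a subgraph $H\subseteq G$ and a color $\alpha$, $H_{L,\alpha}$ is the subgraph of $H$ induced by the vertices $v$ of $H$ with $\alpha\in L(v)$. $|H|$ denotes the number of vertices and $\|H\|$ the number of edges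 of $H$. Let $$\psi_L(H)=\sum_{\alpha\in\operatorname{pot}(L)}\left\lfloor\frac{|H_{L,\alpha}|}{2}\right\rfloor.$$ The pair $(H,L)$ is abundant if $\psi_L(H)\ge\|H\|$, and $(G,L)$ is superabundant if $(H,L)$ is abundant for every subgraph $H\subseteq G$. *)

theory Defs
  imports Main "HOL-Library.Disjoint_Sets" "HOL-Combinatorics.Transposition"
begin

text \<open>
  Edges are abstract objects carrying a two-element set of endpoints, so that parallel edges
  are allowed and loops are not.
\<close>

record ('v, 'e) pre_multigraph =
  verts :: "'v set"
  edges :: "'e set"
  ends :: "'e \<Rightarrow> 'v set"

definition multigraph :: "('v, 'e) pre_multigraph \<Rightarrow> bool" where
  "multigraph G \<longleftrightarrow> finite (verts G) \<and> finite (edges G) \<and>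
     (\<forall>e\<in>edges G. ends G e \<subseteq> verts G \<and> card (ends G e) = 2)"

definition subgraph :: "('v, 'e) pre_multigraph \<Rightarrow> ('v, 'e) pre_multigraph \<Rightarrow> bool" where
  "subgraph H G \<longleftrightarrow> multigraph H \<and> verts H \<subseteq> verts G \<and> edges H \<subseteq> edges G \<and>
     (\<forall>e\<in>edges H. ends H e = ends G e)"

definition induced_subgraph ::
  "('v, 'e) pre_multigraph \<Rightarrow> 'v set \<Rightarrow> ('v, 'e) pre_multigraph" where
  "induced_subgraph H W =
     \<lparr>verts = verts H \<inter> W, edges = {e \<in> edges H. ends H e \<subseteq> W}, ends = ends H\<rparr>"

text \<open>
  List assignments are total functions on the vertex type. Only their values on \<^term>\<open>verts G\<close>
  are ever inspected.
\<close>

definition list_assignment :: "('v, 'e) pre_multigraph \<Rightarrow> ('v \<Rightarrow> 'c set) \<Rightarrow> bool" where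
  "list_assignment G L \<longleftrightarrow> (\<forall>v\<in>verts G. finite (L v))"

definition pot :: "('v, 'e) pre_multigraph \<Rightarrow> ('v \<Rightarrow> 'c set) \<Rightarrow> 'c set" where
  "pot G L = (\<Union>v\<in>verts G. L v)"

definition is_pot :: "('v, 'e) pre_multigraph \<Rightarrow> ('v \<Rightarrow> 'c set) \<Rightarrow> 'c set \<Rightarrow> bool" where
  "is_pot G L P \<longleftrightarrow> finite P \<and> pot G L \<subseteq> P"

definition edge_coloring ::
  "('v, 'e) pre_multigraph \<Rightarrow> ('v \<Rightarrow> 'c set) \<Rightarrow> ('e \<Rightarrow> 'c) \<Rightarrow> bool" where
  "edge_coloring G L \<pi> \<longleftrightarrow>
     (\<forall>e\<in>edges G. \<forall>x\<in>ends G e. \<pi> e \<in> L x) \<and>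
     (\<forall>e\<in>edges G. \<forall>f\<in>edges G. e \<noteq> f \<and> ends G e \<inter> ends G f \<noteq> {} \<longrightarrow> \<pi> e \<noteq> \<pi> f)"

definition swap_set ::
  "('v, 'e) pre_multigraph \<Rightarrow> ('v \<Rightarrow> 'c set) \<Rightarrow> 'c \<Rightarrow> 'c \<Rightarrow> 'v set" where
  "swap_set G L a b = {v \<in> verts G. card ({a, b} \<inter> L v) = 1}"

definition swap_on :: "'c \<Rightarrow> 'c \<Rightarrow> 'v set \<Rightarrow> ('v \<Rightarrow> 'c set) \<Rightarrow> 'v \<Rightarrow> 'c set" where
  "swap_on a b X L = (\<lambda>v. if v \<in> X then transpose a b ` L v else L v)"

text \<open>
  The parts of a partition in the sense of \<^const>\<open>partition_on\<close> are nonempty and pairwise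
  disjoint, hence distinct, so a subset \<open>J\<close> of the index set corresponds to a subset \<open>\<Y>\<close>
  of the set of parts.
\<close>

inductive fixable ::
  "('v, 'e) pre_multigraph \<Rightarrow> 'c set \<Rightarrow> ('v \<Rightarrow> 'c set) \<Rightarrow> bool"
  for G :: "('v, 'e) pre_multigraph" and P :: "'c set" where
  colorable: "edge_coloring G L \<pi> \<Longrightarrow> fixable G P L"
| swap: "\<lbrakk>a \<in> P; b \<in> P; a \<noteq> b;
    \<forall>\<X>. partition_on (swap_set G L a b) \<X> \<and> (\<forall>X\<in>\<X>. card X \<le> 2) \<longrightarrow>
      (\<exists>\<Y>. \<Y> \<subseteq> \<X> \<and> fixable G P (swap_on a b (\<Union>\<Y>) L))\<rbrakk>
    \<Longrightarrow> fixable G P L"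

definition color_subgraph ::
  "('v, 'e) pre_multigraph \<Rightarrow> ('v \<Rightarrow> 'c set) \<Rightarrow> 'c \<Rightarrow> ('v, 'e) pre_multigraph" where
  "color_subgraph H L \<alpha> = induced_subgraph H {v. \<alpha> \<in> L v}"

text \<open>
  The ambient graph \<open>G\<close> on which \<open>L\<close> is a list assignment is an argument of the next two
  definitions because \<open>pot(L)\<close> ranges over all of \<open>G\<close>, not just \<open>H\<close>.
\<close>

definition psi ::
  "('v, 'e) pre_multigraph \<Rightarrow> ('v \<Rightarrow> 'c set) \<Rightarrow> ('v, 'e) pre_multigraph \<Rightarrow> nat" where
  "psi G L H = (\<Sum>\<alpha>\<in>pot G L. card (verts (color_subgraph H L \<alpha>)) div 2)"

definition abundant ::
  "('v, 'e) pre_multigraph \<Rightarrow> ('v \<Rightarrow> 'c set) \<Rightarrow> ('v, 'e) pre_multigraph \<Rightarrow> bool" where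
  "abundant G L H \<longleftrightarrow> psi G L H \<ge> card (edges H)"

definition superabundant :: "('v, 'e) pre_multigraph \<Rightarrow> ('v \<Rightarrow> 'c set) \<Rightarrow> bool" where
  "superabundant G L \<longleftrightarrow> (\<forall>H. subgraph H G \<longrightarrow> abundant G L H)"

end

theory Submission
  imports Defs
begin

text \<open>
  Fix a subgraph \<open>H\<close> and induct on fixability to show that \<open>H\<close> is abundant. If \<open>L\<close> admits an
  edge-coloring, each color class restricted to \<open>H\<close> is a matching whose endpoints all have that
  color in their lists, so color \<open>\<alpha>\<close> is used on at most \<open>\<lfloor>|H\<^sub>\<alpha>|/2\<rfloor>\<close> edges of \<open>H\<close>.

  For the swapping step, it is enough to exhibit one partition of the swap set for which no choice
  of parts changes \<open>\<psi>(H)\<close>: the induction hypothesis then transfers from the swapped lists back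
  to \<open>L\<close>. Write \<open>h\<^sub>\<alpha>\<close> for the number of vertices of \<open>H\<close> with \<open>\<alpha>\<close> in their list. A swap of
  \<open>a\<close> and \<open>b\<close> affects only \<open>h\<^sub>a\<close> and \<open>h\<^sub>b\<close>, and it keeps \<open>h\<^sub>a + h\<^sub>b\<close> fixed. Hence
  \<open>\<lfloor>h\<^sub>a/2\<rfloor> + \<lfloor>h\<^sub>b/2\<rfloor>\<close> can only change when that sum is even and the parity of \<open>h\<^sub>a\<close> changes. But when
  the sum is even, an even number of vertices of \<open>H\<close> lie in the swap set. Pairing these up,
  and leaving the vertices outside \<open>H\<close> as singletons, makes every swap alter an even number of
  vertices of \<open>H\<close>, which preserves the parity of \<open>h\<^sub>a\<close>. The arithmetic is in lemma
  \<open>psi_swap_on\<close> and the choice of the partition in \<open>exists_psi_preserving_partition\<close>.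
\<close>

definition vertex_count :: "('v, 'e) pre_multigraph \<Rightarrow> ('v \<Rightarrow> 'c set) \<Rightarrow> 'c \<Rightarrow> nat" where
  "vertex_count H L \<alpha> = card {v \<in> verts H. \<alpha> \<in> L v}"

lemma verts_color_subgraph: "verts (color_subgraph H L \<alpha>) = {v \<in> verts H. \<alpha> \<in> L v}"
  by (auto simp: color_subgraph_def induced_subgraph_def)

text \<open>
  Swapping can change the pot, so \<open>\<psi>\<close> is rewritten as a sum over the invariant set \<open>P\<close>.
\<close>

lemma psi_eq_sum_over_pot:
  assumes "verts H \<subseteq> verts G" "is_pot G L P"
  shows "psi G L H = (\<Sum>\<alpha>\<in>P. vertex_count H L \<alpha> div 2)"
proof -
  have "vertex_count H L \<alpha> = 0" if "\<alpha> \<in> P - pot G L" for \<alpha>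
  proof -
    have "{v \<in> verts H. \<alpha> \<in> L v} = {}"
      using that assms(1) by (auto simp: pot_def)
    then show ?thesis by (simp only: vertex_count_def card.empty)
  qed
  then show ?thesis
    unfolding psi_def verts_color_subgraph vertex_count_def[symmetric]
    using assms(2) by (intro sum.mono_neutral_left) (auto simp: is_pot_def)
qed

section \<open>Edge-colorings\<close>

text \<open>
  The endpoint sets of a color class are disjoint two-element sets of vertices whose lists
  contain the color.
\<close>

lemma color_class_le_vertex_count:
  assumes "multigraph H" "edge_coloring H L \<pi>"
  shows "card {e \<in> edges H. \<pi> e = \<alpha>} \<le> vertex_count H L \<alpha> div 2"
proof -
  let ?M = "{e \<in> edges H. \<pi> e = \<alpha>}"
  have two: "\<forall>e\<in>?M. card (ends H e) = 2"
    using assms(1) by (auto simp: multigraph_def)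
  then have fin: "\<forall>e\<in>?M. finite (ends H e)"
    by (auto intro: card_ge_0_finite)
  have "\<forall>e\<in>?M. \<forall>f\<in>?M. e \<noteq> f \<longrightarrow> ends H e \<inter> ends H f = {}"
    using assms(2) unfolding edge_coloring_def by (metis (mono_tags, lifting) mem_Collect_eq)
  then have "card (\<Union>e\<in>?M. ends H e) = (\<Sum>e\<in>?M. card (ends H e))"
    using assms(1) fin by (intro card_UN_disjoint) (auto simp: multigraph_def)
  also have "\<dots> = 2 * card ?M" using two by simp
  finally have "2 * card ?M = card (\<Union>e\<in>?M. ends H e)" ..
  also have "\<dots> \<le> vertex_count H L \<alpha>"
    unfolding vertex_count_def using assms
    by (intro card_mono) (auto simp: multigraph_def edge_coloring_def)
  finally show ?thesis by simp
qed

lemma edge_coloring_subgraph: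
  assumes "subgraph H G" "edge_coloring G L \<pi>"
  shows "edge_coloring H L \<pi>"
proof -
  have "edges H \<subseteq> edges G" "\<And>e. e \<in> edges H \<Longrightarrow> ends H e = ends G e"
    using assms(1) by (auto simp: subgraph_def)
  then show ?thesis using assms(2) by (simp add: edge_coloring_def subset_iff)
qed

lemma edge_coloring_in_pot:
  assumes "multigraph G" "edge_coloring G L \<pi>" "e \<in> edges G"
  shows "\<pi> e \<in> pot G L"
proof -
  have "ends G e \<noteq> {}" "ends G e \<subseteq> verts G"
    using assms(1,3) by (auto simp: multigraph_def)
  then show ?thesis using assms(2,3) by (fastforce simp: edge_coloring_def pot_def)
qed

lemma edge_coloring_abundant:
  assumes "multigraph G" "subgraph H G" "is_pot G L P" "edge_coloring G L \<pi>"
  shows "abundant G L H"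
proof -
  have H: "multigraph H" "verts H \<subseteq> verts G" "edges H \<subseteq> edges G"
    using assms(2) by (auto simp: subgraph_def)
  have "\<pi> ` edges H \<subseteq> P"
    using edge_coloring_in_pot[OF assms(1,4)] H(3) assms(3) by (auto simp: is_pot_def)
  then have "card (edges H) = (\<Sum>\<alpha>\<in>P. card {e \<in> edges H. \<pi> e = \<alpha>})"
    using sum.group[of "edges H" P \<pi> "\<lambda>_. 1::nat"] H(1) assms(3)
    by (simp add: multigraph_def is_pot_def)
  also have "\<dots> \<le> (\<Sum>\<alpha>\<in>P. vertex_count H L \<alpha> div 2)"
    using color_class_le_vertex_count[OF H(1) edge_coloring_subgraph[OF assms(2,4)]]
    by (rule sum_mono)
  also have "\<dots> = psi G L H"
    using psi_eq_sum_over_pot[OF H(2) assms(3)] by simp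
  finally show ?thesis by (simp add: abundant_def)
qed

section \<open>Swapping two colors\<close>

lemma mem_swap_on:
  "\<alpha> \<in> swap_on a b X L v \<longleftrightarrow> (if v \<in> X then transpose a b \<alpha> \<in> L v else \<alpha> \<in> L v)"
proof -
  have "\<alpha> \<in> transpose a b ` A \<longleftrightarrow> transpose a b \<alpha> \<in> A" for A
    by (metis image_iff transpose_involutory)
  then show ?thesis by (simp add: swap_on_def)
qed

lemma mem_swap_set:
  assumes "a \<noteq> b"
  shows "v \<in> swap_set G L a b \<longleftrightarrow> v \<in> verts G \<and> (a \<in> L v \<longleftrightarrow> b \<notin> L v)"
  using assms by (cases "a \<in> L v"; cases "b \<in> L v") (auto simp: swap_set_def Int_insert_left)

lemma is_pot_swap_on:
  assumes "is_pot G L P" "a \<in> P" "b \<in> P"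
  shows "is_pot G (swap_on a b X L) P"
proof -
  have "\<alpha> \<in> P" if "v \<in> verts G" "\<alpha> \<in> swap_on a b X L v" for \<alpha> v
  proof -
    have "L v \<subseteq> P" using that(1) assms(1) by (auto simp: is_pot_def pot_def)
    then have "\<alpha> \<in> P \<or> transpose a b \<alpha> \<in> P"
      using that(2) by (auto simp: mem_swap_on split: if_splits)
    then show ?thesis using assms(2,3) by (auto simp: transpose_def split: if_splits)
  qed
  then show ?thesis using assms(1) by (auto simp: is_pot_def pot_def)
qed

lemma card_filter_plus_card_filter:
  assumes "finite A"
  shows "card {x \<in> A. Q x} + card {x \<in> A. R x}
    = 2 * card {x \<in> A. Q x \<and> R x} + card {x \<in> A. Q x \<noteq> R x}"
proof -
  let ?QR = "{x \<in> A. Q x \<and> R x}" and ?D = "{x \<in> A. Q x \<noteq> R x}"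
  have "card {x \<in> A. Q x} + card {x \<in> A. R x}
    = card ({x \<in> A. Q x} \<union> {x \<in> A. R x}) + card ({x \<in> A. Q x} \<inter> {x \<in> A. R x})"
    using assms by (intro card_Un_Int) auto
  also have "{x \<in> A. Q x} \<union> {x \<in> A. R x} = ?QR \<union> ?D" by blast
  also have "{x \<in> A. Q x} \<inter> {x \<in> A. R x} = ?QR" by blast
  also have "card (?QR \<union> ?D) = card ?QR + card ?D"
    using assms by (intro card_Un_disjoint) auto
  finally show ?thesis by simp
qed

text \<open>
  A vertex of the swap set has exactly one of \<open>a\<close> and \<open>b\<close>, so in the sum of the old and new counts of
  \<open>a\<close> a swapped vertex contributes one, and an unswapped vertex zero or two.
\<close>

lemma even_vertex_count_swap_on:
  assumes "finite (verts H)" "a \<noteq> b" "X \<subseteq> swap_set G L a b"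
  shows "even (vertex_count H (swap_on a b X L) a + vertex_count H L a)
    \<longleftrightarrow> even (card (X \<inter> verts H))"
proof -
  have "{v \<in> verts H. (a \<in> swap_on a b X L v) \<noteq> (a \<in> L v)} = X \<inter> verts H"
    using assms(3) by (auto simp: mem_swap_on mem_swap_set[OF assms(2)])
  then show ?thesis
    unfolding vertex_count_def card_filter_plus_card_filter[OF assms(1)] by simp
qed

lemma even_vertex_count_plus:
  assumes "finite (verts H)" "verts H \<subseteq> verts G" "a \<noteq> b"
  shows "even (vertex_count H L a + vertex_count H L b)
    \<longleftrightarrow> even (card (swap_set G L a b \<inter> verts H))"
proof -
  have "{v \<in> verts H. (a \<in> L v) \<noteq> (b \<in> L v)} = swap_set G L a b \<inter> verts H"
    using assms(2) by (auto simp: mem_swap_set[OF assms(3)])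
  then show ?thesis
    unfolding vertex_count_def card_filter_plus_card_filter[OF assms(1)] by simp
qed

text \<open>
  Swapping the two colors in a list preserves how many of them it contains.
\<close>

lemma vertex_count_plus_swap_on:
  assumes "finite (verts H)" "a \<noteq> b"
  shows "vertex_count H (swap_on a b X L) a + vertex_count H (swap_on a b X L) b
    = vertex_count H L a + vertex_count H L b"
proof -
  let ?L = "swap_on a b X L"
  have "(a \<in> ?L v \<and> b \<in> ?L v) = (a \<in> L v \<and> b \<in> L v)"
    and "((a \<in> ?L v) \<noteq> (b \<in> ?L v)) = ((a \<in> L v) \<noteq> (b \<in> L v))" for v
    by (auto simp: mem_swap_on)
  then show ?thesis
    unfolding vertex_count_def card_filter_plus_card_filter[OF assms(1)] by simp
qed

lemma vertex_count_swap_on_other: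
  "\<alpha> \<noteq> a \<Longrightarrow> \<alpha> \<noteq> b \<Longrightarrow> vertex_count H (swap_on a b X L) \<alpha> = vertex_count H L \<alpha>"
  by (simp add: vertex_count_def mem_swap_on)

text \<open>
  Rounding down loses one half per odd summand. An odd sum has exactly one odd summand, and an even
  sum has none or two, according to the parity of either one.
\<close>

lemma half_plus_half_eq:
  fixes x y x' y' :: nat
  assumes "x' + y' = x + y" "even (x + y) \<Longrightarrow> even (x' + x)"
  shows "x' div 2 + y' div 2 = x div 2 + y div 2"
proof -
  have "even x' \<or> even y' \<longleftrightarrow> even x \<or> even y" "even x' \<and> even y' \<longleftrightarrow> even x \<and> even y"
    using assms(2) arg_cong[OF assms(1), of even] by auto
  then have "x' mod 2 + y' mod 2 = x mod 2 + y mod 2"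
    unfolding mod_2_eq_odd by (cases "even x"; cases "even y"; cases "even x'"; cases "even y'") simp_all
  then show ?thesis using assms(1) by (metis div_add1_eq add_right_cancel)
qed

lemma psi_swap_on:
  assumes "finite (verts H)" "verts H \<subseteq> verts G" "is_pot G L P"
    and "a \<in> P" "b \<in> P" "a \<noteq> b" "X \<subseteq> swap_set G L a b"
    and even: "even (card (swap_set G L a b \<inter> verts H)) \<Longrightarrow> even (card (X \<inter> verts H))"
  shows "psi G (swap_on a b X L) H = psi G L H"
proof -
  let ?n = "vertex_count H L" and ?n' = "vertex_count H (swap_on a b X L)"
  have "?n' a div 2 + ?n' b div 2 = ?n a div 2 + ?n b div 2"
    using vertex_count_plus_swap_on[OF assms(1,6)] even
      even_vertex_count_plus[OF assms(1,2,6)] even_vertex_count_swap_on[OF assms(1,6,7)]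
    by (intro half_plus_half_eq) blast+
  moreover have "(\<Sum>\<alpha>\<in>P. f \<alpha>) = f a + f b + (\<Sum>\<alpha>\<in>P - {a} - {b}. f \<alpha>)" for f :: "'c \<Rightarrow> nat"
    using assms(3-6) by (simp add: is_pot_def sum.remove[of P a] sum.remove[of "P - {a}" b])
  moreover have "(\<Sum>\<alpha>\<in>P - {a} - {b}. ?n' \<alpha> div 2) = (\<Sum>\<alpha>\<in>P - {a} - {b}. ?n \<alpha> div 2)"
    by (intro sum.cong) (auto simp: vertex_count_swap_on_other)
  ultimately show ?thesis
    using psi_eq_sum_over_pot[OF assms(2,3)]
      psi_eq_sum_over_pot[OF assms(2) is_pot_swap_on[OF assms(3-5)]]
    by simp
qed

section \<open>A partition whose swaps preserve \<open>\<psi>\<close>\<close>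

lemma exists_pair_partition:
  assumes "finite A" "even (card A)"
  shows "\<exists>\<X>. partition_on A \<X> \<and> (\<forall>X\<in>\<X>. card X = 2)"
  using assms
proof (induction A rule: finite_psubset_induct)
  case (psubset A)
  show ?case
  proof (cases "A = {}")
    case True
    then show ?thesis by (auto simp: partition_on_empty)
  next
    case False
    then have "2 \<le> card A"
      using psubset.hyps psubset.prems by (metis card_0_eq dvd_imp_le gr0I)
    then obtain B where B: "B \<subseteq> A" "card B = 2"
      using obtain_subset_with_card_n by metis
    then have "B \<noteq> {}" "finite B" by (auto intro: card_ge_0_finite)
    then have "A - B \<subset> A" "even (card (A - B))"
      using B psubset.prems by (auto simp: card_Diff_subset)
    then obtain \<X> where \<X>: "partition_on (A - B) \<X>" "\<forall>X\<in>\<X>. card X = 2"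
      using psubset.IH by blast
    have "disjnt B (\<Union>\<X>)"
      using partition_onD1[OF \<X>(1)] by (auto simp: disjnt_def)
    then have "partition_on A (insert B \<X>)"
      using \<X>(1) B(1) \<open>B \<noteq> {}\<close> by (simp add: partition_on_insert)
    then show ?thesis using \<X>(2) B(2) by auto
  qed
qed

text \<open>
  In the even case, pair up \<open>S \<inter> V\<close> and split \<open>S - V\<close> into singletons, so that each part has two
  elements of \<open>V\<close> or none. Otherwise singletons will do throughout.
\<close>

lemma exists_even_partition:
  assumes "finite V"
  shows "\<exists>\<X>. partition_on S \<X> \<and> (\<forall>X\<in>\<X>. card X \<le> 2) \<and>
    (even (card (S \<inter> V)) \<longrightarrow> (\<forall>\<Y>\<subseteq>\<X>. even (card (\<Union>\<Y> \<inter> V))))"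
proof (cases "even (card (S \<inter> V))")
  case False
  then show ?thesis using partition_on_singletons[of S] by (intro exI[of _ "(\<lambda>x. {x}) ` S"]) auto
next
  case True
  then obtain \<X> where \<X>: "partition_on (S \<inter> V) \<X>" "\<forall>X\<in>\<X>. card X = 2"
    using exists_pair_partition[of "S \<inter> V"] assms by auto
  let ?Z = "(\<lambda>x. {x}) ` (S - V)"
  have "partition_on S (\<X> \<union> ?Z)"
  proof (rule partition_onI)
    have union: "\<Union>\<X> = S \<inter> V" using partition_onD1[OF \<X>(1)] ..
    then show "\<Union>(\<X> \<union> ?Z) = S" by auto
    show "disjnt X Y" if "X \<in> \<X> \<union> ?Z" "Y \<in> \<X> \<union> ?Z" "X \<noteq> Y" for X Y
    proof (cases "X \<in> \<X> \<and> Y \<in> \<X>")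
      case True
      then show ?thesis
        using partition_onD2[OF \<X>(1)] that(3) by (auto simp: pairwise_def)
    next
      case False
      then show ?thesis using union that by (fastforce simp: disjnt_def)
    qed
    show "{} \<notin> \<X> \<union> ?Z" using partition_onD3[OF \<X>(1)] by auto
  qed
  moreover have "even (card (\<Union>\<Y> \<inter> V))" if "\<Y> \<subseteq> \<X> \<union> ?Z" for \<Y>
  proof -
    have sub: "\<Union>\<X> \<subseteq> V" using \<X>(1) by (auto simp: partition_on_def)
    have "\<Union>\<Y> \<inter> V = \<Union>(\<Y> \<inter> \<X>)"
    proof
      show "\<Union>\<Y> \<inter> V \<subseteq> \<Union>(\<Y> \<inter> \<X>)" using that by fastforce
      show "\<Union>(\<Y> \<inter> \<X>) \<subseteq> \<Union>\<Y> \<inter> V" using sub by blast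
    qed
    also have "card \<dots> = (\<Sum>X\<in>\<Y> \<inter> \<X>. card X)"
      using \<X> by (intro card_Union_disjoint)
        (auto simp: partition_on_def disjoint_def pairwise_def disjnt_def intro: card_ge_0_finite)
    finally show ?thesis using \<X>(2) by (simp add: dvd_sum)
  qed
  ultimately show ?thesis
    using \<X>(2) by (intro exI[of _ "\<X> \<union> ?Z"]) auto
qed

lemma exists_psi_preserving_partition:
  assumes "finite (verts H)" "verts H \<subseteq> verts G" "is_pot G L P" "a \<in> P" "b \<in> P" "a \<noteq> b"
  shows "\<exists>\<X>. partition_on (swap_set G L a b) \<X> \<and> (\<forall>X\<in>\<X>. card X \<le> 2) \<and>
    (\<forall>\<Y>\<subseteq>\<X>. psi G (swap_on a b (\<Union>\<Y>) L) H = psi G L H)"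
proof -
  let ?S = "swap_set G L a b"
  obtain \<X> where \<X>: "partition_on ?S \<X>" "\<forall>X\<in>\<X>. card X \<le> 2"
    and even: "even (card (?S \<inter> verts H)) \<longrightarrow> (\<forall>\<Y>\<subseteq>\<X>. even (card (\<Union>\<Y> \<inter> verts H)))"
    using exists_even_partition[OF assms(1), of ?S] by blast
  have "psi G (swap_on a b (\<Union>\<Y>) L) H = psi G L H" if "\<Y> \<subseteq> \<X>" for \<Y>
  proof (rule psi_swap_on[OF assms])
    show "\<Union>\<Y> \<subseteq> ?S" using that \<X>(1) by (auto simp: partition_on_def)
  qed (use even that in blast)
  then show ?thesis using \<X> by blast
qed

section \<open>Fixability implies superabundance\<close>

lemma fixable_abundant:
  assumes "fixable G P L" "multigraph G" "subgraph H G" "is_pot G L P"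
  shows "abundant G L H"
  using assms(1,4)
proof (induction rule: fixable.induct)
  case (colorable L \<pi>)
  then show ?case using edge_coloring_abundant[OF assms(2,3)] by blast
next
  case (swap a b L)
  have "finite (verts H)" "verts H \<subseteq> verts G"
    using assms(3) by (auto simp: subgraph_def multigraph_def)
  then obtain \<X> where \<X>: "partition_on (swap_set G L a b) \<X>" "\<forall>X\<in>\<X>. card X \<le> 2"
    and psi: "\<forall>\<Y>\<subseteq>\<X>. psi G (swap_on a b (\<Union>\<Y>) L) H = psi G L H"
    using exists_psi_preserving_partition swap.hyps swap.prems by metis
  obtain \<Y> where "\<Y> \<subseteq> \<X>" "abundant G (swap_on a b (\<Union>\<Y>) L) H"
    using swap.IH[rule_format, OF conjI, OF \<X>(1)] \<X>(2)
      is_pot_swap_on[OF swap.prems swap.hyps(1,2)] by auto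
  then show ?case using psi by (simp add: abundant_def)
qed

theorem lemma2p2:
  fixes G :: "('v, 'e) pre_multigraph"
    and L :: "'v \<Rightarrow> 'c set"
    and P :: "'c set"
  assumes "multigraph G"
    and "list_assignment G L"
    and "is_pot G L P"
    and "fixable G P L"
  shows "superabundant G L"
  using fixable_abundant[OF assms(4,1) _ assms(3)] by (auto simp: superabundant_def)

end
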